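(* Let $\mathrm{SM}(\hat q)=\{p(\cdot,\theta):\theta\in\Theta\}$ be a simple mixture family and let $p\in L^2$ be a probability density outside $\mathrm{SM}(\hat q)$. Suppose that the matrix $\gamma$ of the family is positive definite. Let $$\tilde m=E_p[q-\underline1q_{n+1}],\qquad m(\theta)=E_\theta[q-\underline1q_{n+1}]=\gamma\theta+\beta,\qquad\beta=E_{q_{n+1}}[q-q_{n+1}\underline1],$$ and suppose that $\theta^*=\gamma^{-1}(\tilde m-\beta)\in\Theta$. Then the minimization problem $$\min_{\theta\in\Theta}\|p-p(\cdot,\theta)\|_2$$ has a unique solution, characterized by the moment matching condition $\tilde m=m(\theta)$ (that is, the solution is $\theta=\theta^*$).
   Context: $\|\cdot\|_2$ and $\langle\cdot,\cdot\rangle$ are the norm and inner product of $L^2(\mathbb R^N,dx)$. Simple mixture family: $\hat q=[q_1,\dots,q_{n+1}]'$ are $n+1$ fixed square integrable probability densities on $\mathbb R^N$, $q=[q_1,\dots,q_n]'$, $\underline1$ is the vector with $n$ components equal to $1$, $\hat\theta(\theta)=[\theta_1,\dots,\theta_n,1-\theta_1-\dots-\theta_n]'$, and $p(\cdot,\theta)=\hat\theta(\theta)'\hat q$ for $\theta\in\Theta$, where $\Theta$ is an open convex subset of $\mathbb R^n$ contained in $\{\theta:\theta_i\in[0,1]\ \forall i,\ 0<\sum_{i=1}^n\theta_i<1\}$. The matrix $\gamma$ is $\gamma_{ij}=\langle q_i-q_{n+1},q_j-q_{n+1}\rangle$, $i,j=1,\dots,n$. $E_\theta[\varphi]=\int\varphi(x)p(x,\theta)\,dx$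 and $E_p[\varphi]=\int\varphi(x)p(x)\,dx$ for a density $p$. *)

theory Defs
  imports "HOL-Analysis.Analysis"
begin

text \<open>
  Elements of \<open>L\<^sup>2\<close> are represented by Lebesgue measurable functions; equality in \<open>L\<^sup>2\<close> is
  equality almost everywhere.
\<close>

definition inner_L2 :: "(real^'N \<Rightarrow> real) \<Rightarrow> (real^'N \<Rightarrow> real) \<Rightarrow> real" where
  "inner_L2 f g = (LINT x|lebesgue. f x * g x)"

definition norm_L2 :: "(real^'N \<Rightarrow> real) \<Rightarrow> real" where
  "norm_L2 f = sqrt (inner_L2 f f)"

definition square_integrable :: "(real^'N \<Rightarrow> real) \<Rightarrow> bool" where
  "square_integrable f \<longleftrightarrow>
     f \<in> borel_measurable lebesgue \<and> integrable lebesgue (\<lambda>x. (f x)\<^sup>2)"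

definition prob_density :: "(real^'N \<Rightarrow> real) \<Rightarrow> bool" where
  "prob_density f \<longleftrightarrow>
     integrable lebesgue f \<and> (AE x in lebesgue. 0 \<le> f x) \<and> (LINT x|lebesgue. f x) = 1"

definition expect ::
  "(real^'N \<Rightarrow> real) \<Rightarrow> (real^'N \<Rightarrow> 'b::{banach, second_countable_topology}) \<Rightarrow> 'b" where
  "expect p \<phi> = (LINT x|lebesgue. p x *\<^sub>R \<phi> x)"

definition positive_definite :: "real^'n^'n \<Rightarrow> bool" where
  "positive_definite A \<longleftrightarrow> transpose A = A \<and> (\<forall>v. v \<noteq> 0 \<longrightarrow> 0 < v \<bullet> (A *v v))"

text \<open>
  The \<open>n + 1\<close> densities are indexed by \<open>'n option\<close>, where \<open>n = CARD('n)\<close>: \<open>Some i\<close> stands for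
  the index \<open>i \<in> {1..n}\<close> and \<open>None\<close> for the index \<open>n + 1\<close>.
\<close>

definition theta_hat :: "real^'n \<Rightarrow> real^('n option)" where
  "theta_hat \<theta> =
     (\<chi> k. case k of Some i \<Rightarrow> \<theta> $ i | None \<Rightarrow> 1 - (\<Sum>i\<in>UNIV. \<theta> $ i))"

definition mixture :: "(real^'N \<Rightarrow> real^('n option)) \<Rightarrow> real^'n \<Rightarrow> real^'N \<Rightarrow> real" where
  "mixture qh \<theta> x = theta_hat \<theta> \<bullet> qh x"

definition SM :: "(real^'N \<Rightarrow> real^('n option)) \<Rightarrow> (real^'n) set \<Rightarrow> (real^'N \<Rightarrow> real) set" where
  "SM qh \<Theta> = {mixture qh \<theta> |\<theta>. \<theta> \<in> \<Theta>}"

definition simple_mixture_family ::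
  "(real^'N \<Rightarrow> real^('n option)) \<Rightarrow> (real^'n) set \<Rightarrow> bool" where
  "simple_mixture_family qh \<Theta> \<longleftrightarrow>
     (\<forall>k. prob_density (\<lambda>x. qh x $ k) \<and> square_integrable (\<lambda>x. qh x $ k)) \<and>
     open \<Theta> \<and> convex \<Theta> \<and>
     \<Theta> \<subseteq> {\<theta>. (\<forall>i. \<theta> $ i \<in> {0..1}) \<and> 0 < (\<Sum>i\<in>UNIV. \<theta> $ i) \<and> (\<Sum>i\<in>UNIV. \<theta> $ i) < 1}"

text \<open>The vector of functions \<open>q - \<one> q\<^sub>n\<^sub>+\<^sub>1\<close>; here \<open>1 :: real^'n\<close> has all components equal to 1.\<close>

definition q_diff :: "(real^'N \<Rightarrow> real^('n option)) \<Rightarrow> real^'N \<Rightarrow> real^'n" where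
  "q_diff qh x = (\<chi> i. qh x $ Some i) - (qh x $ None) *\<^sub>R 1"

definition gamma_matrix :: "(real^'N \<Rightarrow> real^('n option)) \<Rightarrow> real^'n^'n" where
  "gamma_matrix qh =
     (\<chi> i j. inner_L2 (\<lambda>x. qh x $ Some i - qh x $ None) (\<lambda>x. qh x $ Some j - qh x $ None))"

definition moment :: "(real^'N \<Rightarrow> real^('n option)) \<Rightarrow> real^'n \<Rightarrow> real^'n" where
  "moment qh \<theta> = expect (mixture qh \<theta>) (q_diff qh)"

definition beta_vec :: "(real^'N \<Rightarrow> real^('n option)) \<Rightarrow> real^'n" where
  "beta_vec qh = expect (\<lambda>x. qh x $ None) (q_diff qh)"

end

theory Submission
  imports Defs
begin

text \<open>
  The densities of the family form an affine family \<open>q\<^sub>n\<^sub>+\<^sub>1 + \<theta> \<bullet> d\<close> with direction functions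
  \<open>d = q - \<one> q\<^sub>n\<^sub>+\<^sub>1\<close>, and \<open>\<gamma>\<close> is the Gram matrix of \<open>d\<close> in \<open>L\<^sup>2\<close>. Minimising the distance to \<open>p\<close> is
  therefore an orthogonal projection problem: \<open>\<theta>\<close> solves it as soon as the residual
  \<open>p - p(\<cdot>,\<theta>)\<close> is orthogonal to every component of \<open>d\<close>. Since
  \<open>\<langle>f, v \<bullet> d\<rangle> = v \<bullet> E\<^sub>f[d]\<close> (lemma \<open>inner_L2_q_diff\<close>), this orthogonality is exactly the moment matching
  condition.

  Quantitatively, if \<open>\<theta>\<^sub>0\<close> matches the moments of \<open>p\<close>, Pythagoras' theorem
  (lemma \<open>mixture_pythagoras\<close>) reads
  \<open>\<parallel>p - p(\<cdot>,\<theta>)\<parallel>\<^sup>2 = \<parallel>p - p(\<cdot>,\<theta>\<^sub>0)\<parallel>\<^sup>2 + (\<theta> - \<theta>\<^sub>0) \<bullet> \<gamma> (\<theta> - \<theta>\<^sub>0)\<close>, and positive definiteness makes \<open>\<theta>\<^sub>0\<close> the strict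
  minimiser. Because the moments are the affine function \<open>\<gamma> \<theta> + \<beta>\<close> (lemma \<open>moment_affine\<close>) and
  \<open>\<gamma>\<close> is invertible, the only parameter that matches them is \<open>\<gamma>\<^sup>-\<^sup>1 (m - \<beta>)\<close>, where \<open>m = E\<^sub>p[d]\<close>.
\<close>

lemma integrable_mult_square_integrable:
  assumes "square_integrable f" "square_integrable g"
  shows "integrable lebesgue (\<lambda>x. f x * g x)"
proof (rule Bochner_Integration.integrable_bound)
  show "integrable lebesgue (\<lambda>x. (f x)\<^sup>2 + (g x)\<^sup>2)"
    using assms by (auto simp: square_integrable_def)
  show "(\<lambda>x. f x * g x) \<in> borel_measurable lebesgue"
    using assms by (auto simp: square_integrable_def)
  have "\<bar>a * b\<bar> \<le> a\<^sup>2 + b\<^sup>2" for a b :: real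
  proof -
    have "2 * (\<bar>a\<bar> * \<bar>b\<bar>) \<le> a\<^sup>2 + b\<^sup>2"
      using sum_squares_bound[of "\<bar>a\<bar>" "\<bar>b\<bar>"] by (simp add: mult.assoc)
    moreover have "0 \<le> \<bar>a\<bar> * \<bar>b\<bar>" by simp
    ultimately show ?thesis unfolding abs_mult by linarith
  qed
  then show "AE x in lebesgue. norm (f x * g x) \<le> norm ((f x)\<^sup>2 + (g x)\<^sup>2)"
    by simp
qed

lemma square_integrable_add:
  assumes f: "square_integrable f" and g: "square_integrable g"
  shows "square_integrable (\<lambda>x. f x + g x)"
proof -
  have "integrable lebesgue (\<lambda>x. (f x)\<^sup>2 + (g x)\<^sup>2 + 2 * (f x * g x))"
    using f g integrable_mult_square_integrable[OF f g]
    by (auto simp: square_integrable_def)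
  then have "integrable lebesgue (\<lambda>x. (f x + g x)\<^sup>2)"
    by (simp add: power2_sum mult.assoc)
  then show ?thesis
    using f g by (auto simp: square_integrable_def)
qed

lemma square_integrable_cmult:
  assumes "square_integrable f"
  shows "square_integrable (\<lambda>x. c * f x)"
  using assms by (auto simp: square_integrable_def power_mult_distrib)

lemma square_integrable_diff:
  assumes "square_integrable f" "square_integrable g"
  shows "square_integrable (\<lambda>x. f x - g x)"
  using square_integrable_add[OF assms(1) square_integrable_cmult[OF assms(2), of "-1"]]
  by simp

lemma square_integrable_sum:
  assumes "finite I" "\<And>i. i \<in> I \<Longrightarrow> square_integrable (f i)"
  shows "square_integrable (\<lambda>x. \<Sum>i\<in>I. f i x)"
  using assms
proof (induction I rule: finite_induct)
  case empty
  then show ?case by (simp add: square_integrable_def)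
next
  case (insert i I)
  then show ?case by (simp add: square_integrable_add)
qed

lemma q_diff_nth: "q_diff qh x $ i = qh x $ Some i - qh x $ None"
  by (simp add: q_diff_def)

lemma mixture_eq_affine: "mixture qh \<theta> x = qh x $ None + \<theta> \<bullet> q_diff qh x"
proof -
  have "mixture qh \<theta> x = (1 - (\<Sum>i\<in>UNIV. \<theta> $ i)) * qh x $ None + (\<Sum>i\<in>UNIV. \<theta> $ i * qh x $ Some i)"
    by (simp add: mixture_def theta_hat_def inner_vec_def UNIV_option_conv sum.reindex)
  then show ?thesis
    by (simp add: inner_vec_def q_diff_nth algebra_simps sum_subtractf sum_distrib_left)
qed

lemma square_integrable_inner_q_diff:
  assumes "\<And>k. square_integrable (\<lambda>x. qh x $ k)"
  shows "square_integrable (\<lambda>x. v \<bullet> q_diff qh x)"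
  unfolding inner_vec_def inner_real_def q_diff_nth
  by (intro square_integrable_sum square_integrable_cmult square_integrable_diff assms) simp

lemma square_integrable_mixture:
  assumes "\<And>k. square_integrable (\<lambda>x. qh x $ k)"
  shows "square_integrable (mixture qh \<theta>)"
proof -
  have "mixture qh \<theta> = (\<lambda>x. qh x $ None + \<theta> \<bullet> q_diff qh x)"
    by (rule ext) (rule mixture_eq_affine)
  then show ?thesis
    by (simp add: square_integrable_add square_integrable_inner_q_diff assms)
qed

lemma integrable_scaleR_q_diff:
  assumes f: "square_integrable f" and qh: "\<And>k. square_integrable (\<lambda>x. qh x $ k)"
  shows "integrable lebesgue (\<lambda>x. f x *\<^sub>R q_diff qh x)"
proof -
  have "f x *\<^sub>R q_diff qh x = (\<Sum>i\<in>UNIV. (f x * (qh x $ Some i - qh x $ None)) *\<^sub>R axis i 1)" for x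
    by (simp add: vec_eq_iff q_diff_nth axis_def if_distrib cong: if_cong)
  moreover have "integrable lebesgue
    (\<lambda>x. \<Sum>i\<in>UNIV. (f x * (qh x $ Some i - qh x $ None)) *\<^sub>R (axis i 1 :: real^'b))"
    by (intro Bochner_Integration.integrable_sum integrable_scaleR_left
        integrable_mult_square_integrable square_integrable_diff f qh)
  ultimately show ?thesis by simp
qed

text \<open>
  The inner product with a fixed vector commutes with the vector-valued integral. Applied to the
  difference of two densities, this says that their moments match exactly when that difference is
  orthogonal to all directions of the family.
\<close>

lemma inner_L2_q_diff:
  assumes "square_integrable f" "\<And>k. square_integrable (\<lambda>x. qh x $ k)"
  shows "inner_L2 f (\<lambda>x. v \<bullet> q_diff qh x) = v \<bullet> expect f (q_diff qh)"
proof -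
  have "v \<bullet> expect f (q_diff qh) = (LINT x|lebesgue. v \<bullet> (f x *\<^sub>R q_diff qh x))"
    unfolding expect_def
    by (rule integral_inner_right[symmetric]) (rule integrable_scaleR_q_diff[OF assms])
  then show ?thesis by (simp add: inner_L2_def)
qed

lemma expect_add_q_diff:
  assumes "square_integrable f" "square_integrable g" "\<And>k. square_integrable (\<lambda>x. qh x $ k)"
  shows "expect (\<lambda>x. f x + g x) (q_diff qh) = expect f (q_diff qh) + expect g (q_diff qh)"
  unfolding expect_def scaleR_add_left
  by (intro Bochner_Integration.integral_add integrable_scaleR_q_diff assms)

lemma expect_diff_q_diff:
  assumes "square_integrable f" "square_integrable g" "\<And>k. square_integrable (\<lambda>x. qh x $ k)"
  shows "expect (\<lambda>x. f x - g x) (q_diff qh) = expect f (q_diff qh) - expect g (q_diff qh)"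
  unfolding expect_def scaleR_diff_left
  by (intro Bochner_Integration.integral_diff integrable_scaleR_q_diff assms)

text \<open>
  Component \<open>i\<close> of the left side is \<open>\<langle>w \<bullet> d, d\<^sub>i\<rangle>\<close>, which expands bilinearly into row \<open>i\<close> of the Gram
  matrix applied to \<open>w\<close>. This one identity gives both the linear part of the moment map and,
  paired with \<open>w\<close>, the squared norm of \<open>w \<bullet> d\<close>.
\<close>

lemma expect_inner_q_diff:
  assumes qh: "\<And>k. square_integrable (\<lambda>x. qh x $ k)"
  shows "expect (\<lambda>x. w \<bullet> q_diff qh x) (q_diff qh) = gamma_matrix qh *v w"
proof (rule vec_eq_iff[THEN iffD2], rule allI)
  fix i
  let ?d = "\<lambda>i x. qh x $ Some i - qh x $ None"
  have d: "square_integrable (?d i)" for i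
    by (intro square_integrable_diff qh)
  have "expect (\<lambda>x. w \<bullet> q_diff qh x) (q_diff qh) $ i
      = axis i 1 \<bullet> expect (\<lambda>x. w \<bullet> q_diff qh x) (q_diff qh)"
    by (simp add: inner_axis')
  also have "\<dots> = inner_L2 (\<lambda>x. w \<bullet> q_diff qh x) (\<lambda>x. axis i 1 \<bullet> q_diff qh x)"
    by (rule inner_L2_q_diff[OF square_integrable_inner_q_diff[OF qh] qh, symmetric])
  also have "\<dots> = (LINT x|lebesgue. (\<Sum>j\<in>UNIV. w $ j * (?d i x * ?d j x)))"
    unfolding inner_L2_def inner_axis'
    by (simp add: q_diff_nth inner_vec_def sum_distrib_left mult_ac)
  also have "\<dots> = (\<Sum>j\<in>UNIV. w $ j * inner_L2 (?d i) (?d j))"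
    by (simp add: inner_L2_def Bochner_Integration.integral_sum
        integrable_mult_square_integrable[OF d d])
  also have "\<dots> = (gamma_matrix qh *v w) $ i"
    by (simp add: gamma_matrix_def matrix_vector_mult_def mult.commute)
  finally show "expect (\<lambda>x. w \<bullet> q_diff qh x) (q_diff qh) $ i = (gamma_matrix qh *v w) $ i" .
qed

lemma moment_affine:
  assumes "\<And>k. square_integrable (\<lambda>x. qh x $ k)"
  shows "moment qh \<theta> = gamma_matrix qh *v \<theta> + beta_vec qh"
proof -
  have "mixture qh \<theta> = (\<lambda>x. qh x $ None + \<theta> \<bullet> q_diff qh x)"
    by (rule ext) (rule mixture_eq_affine)
  then show ?thesis
    by (simp add: moment_def beta_vec_def expect_add_q_diff expect_inner_q_diff
        square_integrable_inner_q_diff assms)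
qed

lemma inner_L2_diff_self:
  assumes f: "square_integrable f" and g: "square_integrable g"
  shows "inner_L2 (\<lambda>x. f x - g x) (\<lambda>x. f x - g x) = inner_L2 f f - 2 * inner_L2 f g + inner_L2 g g"
proof -
  have "(f x - g x) * (f x - g x) = f x * f x - 2 * (f x * g x) + g x * g x" for x
    by (simp add: algebra_simps)
  then show ?thesis
    using integrable_mult_square_integrable[OF f f] integrable_mult_square_integrable[OF f g]
      integrable_mult_square_integrable[OF g g]
    by (simp add: inner_L2_def)
qed

text \<open>
  The residual at a moment matching parameter is orthogonal to all directions, so moving by
  \<open>\<theta> - \<theta>\<^sub>0\<close> adds the squared norm of \<open>(\<theta> - \<theta>\<^sub>0) \<bullet> d\<close>, which is the quadratic form of \<open>\<gamma>\<close>.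
\<close>

lemma mixture_pythagoras:
  assumes qh: "\<And>k. square_integrable (\<lambda>x. qh x $ k)"
    and p: "square_integrable p"
    and match: "expect p (q_diff qh) = moment qh \<theta>\<^sub>0"
  shows "inner_L2 (\<lambda>x. p x - mixture qh \<theta> x) (\<lambda>x. p x - mixture qh \<theta> x)
    = inner_L2 (\<lambda>x. p x - mixture qh \<theta>\<^sub>0 x) (\<lambda>x. p x - mixture qh \<theta>\<^sub>0 x)
      + (\<theta> - \<theta>\<^sub>0) \<bullet> (gamma_matrix qh *v (\<theta> - \<theta>\<^sub>0))"
proof -
  let ?r = "\<lambda>x. p x - mixture qh \<theta>\<^sub>0 x" and ?h = "\<lambda>x. (\<theta> - \<theta>\<^sub>0) \<bullet> q_diff qh x"
  have r: "square_integrable ?r"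
    by (intro square_integrable_diff square_integrable_mixture p qh)
  have h: "square_integrable ?h"
    by (intro square_integrable_inner_q_diff qh)
  have "inner_L2 ?r ?h = (\<theta> - \<theta>\<^sub>0) \<bullet> (expect p (q_diff qh) - moment qh \<theta>\<^sub>0)"
    unfolding inner_L2_q_diff[OF r qh] moment_def
    by (simp add: expect_diff_q_diff[OF p square_integrable_mixture[OF qh] qh])
  then have orthogonal: "inner_L2 ?r ?h = 0"
    by (simp add: match)
  have "(\<lambda>x. p x - mixture qh \<theta> x) = (\<lambda>x. ?r x - ?h x)"
    by (simp add: mixture_eq_affine algebra_simps)
  then show ?thesis
    by (simp only: inner_L2_diff_self[OF r h] orthogonal inner_L2_q_diff[OF h qh]
        expect_inner_q_diff[OF qh] mult_zero_right diff_zero)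
qed

lemma positive_definite_matrix_inv:
  fixes A :: "real^'n^'n"
  assumes "positive_definite A"
  shows "A *v (matrix_inv A *v y) = y"
proof -
  have "x = 0" if "A *v x = 0" for x
    using assms that by (force simp: positive_definite_def)
  then have "invertible A"
    by (simp add: invertible_left_inverse matrix_left_invertible_ker)
  then have "A ** matrix_inv A = mat 1"
    unfolding invertible_def matrix_inv_def by (rule someI_ex[THEN conjunct1])
  then show ?thesis
    by (simp add: matrix_vector_mul_assoc)
qed

theorem theorem4p4:
  fixes qh :: "real^'N \<Rightarrow> real^('n::finite option)"
    and \<Theta> :: "(real^'n) set"
    and p :: "real^'N \<Rightarrow> real"
    and mt \<theta>s :: "real^'n"
  assumes family: "simple_mixture_family qh \<Theta>"
    and p_density: "prob_density p"
    and p_L2: "square_integrable p"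
    and p_outside: "\<forall>f\<in>SM qh \<Theta>. \<not> (AE x in lebesgue. p x = f x)"
    and gamma_pd: "positive_definite (gamma_matrix qh)"
    and mt: "mt = expect p (q_diff qh)"
    and \<theta>s: "\<theta>s = matrix_inv (gamma_matrix qh) *v (mt - beta_vec qh)"
    and \<theta>s_in: "\<theta>s \<in> \<Theta>"
  shows "(\<forall>\<theta>\<in>\<Theta>. moment qh \<theta> = gamma_matrix qh *v \<theta> + beta_vec qh) \<and>
    (\<exists>!\<theta>. is_arg_min (\<lambda>\<theta>. norm_L2 (\<lambda>x. p x - mixture qh \<theta> x)) (\<lambda>\<theta>. \<theta> \<in> \<Theta>) \<theta>) \<and>
    (\<forall>\<theta>\<in>\<Theta>. is_arg_min (\<lambda>\<theta>. norm_L2 (\<lambda>x. p x - mixture qh \<theta> x)) (\<lambda>\<theta>. \<theta> \<in> \<Theta>) \<theta>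
       \<longleftrightarrow> mt = moment qh \<theta>) \<and>
    is_arg_min (\<lambda>\<theta>. norm_L2 (\<lambda>x. p x - mixture qh \<theta> x)) (\<lambda>\<theta>. \<theta> \<in> \<Theta>) \<theta>s"
proof -
  let ?N = "\<lambda>\<theta>. norm_L2 (\<lambda>x. p x - mixture qh \<theta> x)"
  let ?min = "is_arg_min ?N (\<lambda>\<theta>. \<theta> \<in> \<Theta>)"
  have qh: "square_integrable (\<lambda>x. qh x $ k)" for k
    using family by (simp add: simple_mixture_family_def)
  have match: "mt = moment qh \<theta>s"
    by (simp add: moment_affine[OF qh] \<theta>s positive_definite_matrix_inv[OF gamma_pd])
  have form_pos: "0 < (\<theta> - \<theta>s) \<bullet> (gamma_matrix qh *v (\<theta> - \<theta>s))" if "\<theta> \<noteq> \<theta>s" for \<theta>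
    using gamma_pd that by (simp add: positive_definite_def)
  have strict: "?N \<theta>s < ?N \<theta>" if "\<theta> \<noteq> \<theta>s" for \<theta>
    using mixture_pythagoras[OF qh p_L2, of \<theta>s \<theta>] form_pos[OF that] match mt
    by (simp add: norm_L2_def)
  have min_iff: "?min \<theta> \<longleftrightarrow> \<theta> = \<theta>s" for \<theta>
  proof
    assume "?min \<theta>"
    then have "\<not> ?N \<theta>s < ?N \<theta>"
      using \<theta>s_in by (simp add: is_arg_min_def)
    then show "\<theta> = \<theta>s"
      using strict by blast
  next
    have "\<not> ?N \<phi> < ?N \<theta>s" for \<phi>
      using strict[of \<phi>] by (cases "\<phi> = \<theta>s") simp_all
    then show "?min \<theta>" if "\<theta> = \<theta>s"
      using that \<theta>s_in by (simp add: is_arg_min_def)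
  qed
  have unique_match: "\<theta> = \<theta>s" if "mt = moment qh \<theta>" for \<theta>
  proof -
    have "gamma_matrix qh *v (\<theta> - \<theta>s) = 0"
      using that match by (simp add: moment_affine[OF qh] matrix_vector_mult_diff_distrib)
    then show ?thesis
      using form_pos[of \<theta>] by auto
  qed
  show ?thesis
  proof (intro conjI ballI)
    show "moment qh \<theta> = gamma_matrix qh *v \<theta> + beta_vec qh" for \<theta>
      by (rule moment_affine[OF qh])
    show "\<exists>!\<theta>. ?min \<theta>" "?min \<theta>s"
      by (simp_all add: min_iff)
    show "?min \<theta> \<longleftrightarrow> mt = moment qh \<theta>" for \<theta>
      unfolding min_iff using match unique_match by blast
  qed
qed

end
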